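(* For all integers $n\ge 3$ and $k\ge 0$, $$\begin{aligned} n f_{n,k}={}&(2+k-n)f_{n-1,k}+(2n-k-1)f_{n-1,k-1}-(n+3k+k^2)f_{n-2,k}\\ &+(-2+4k+2k^2-2kn)f_{n-2,k-1}+(2-k-k^2+2kn-n^2)f_{n-2,k-2}\\ &+(-n-k^2-2k+2)f_{n-3,k}+(-7+4k+3k^2+2n-2kn)f_{n-3,k-1}\\ &+(8-2k-3k^2-2n+4kn-n^2)f_{n-3,k-2}+(-3+k^2+n-2kn+n^2)f_{n-3,k-3}. \end{aligned}$$
   Context: Let $S_n$ be the symmetric group on $[n]=\{1,\dots,n\}$ and $\mathscr{I}_n\subseteq S_n$ the set of involutions, i.e. permutations $\sigma$ with $\sigma^2=\mathrm{id}$ (the identity included). For $\sigma\in S_n$, $\mathrm{ris}(\sigma)$ is the number of rises of $\sigma$, i.e. the number of $i\in\{1,\dots,n-1\}$ with $\sigma(i)<\sigma(i+1)$, and $\mathrm{sgn}(\sigma)\in\{1,-1\}$ is the sign of $\sigma$. The signed Eulerian numbers on involutions $f_{n,k}$ are the coefficients of $$F_n(t)=\sum_{\sigma\in\mathscr{I}_n}\mathrm{sgn}(\sigma)\,t^{\mathrm{ris}(\sigma)}=\sum_{k}f_{n,k}t^k ,$$ where $F_0(t)=1$ (so $f_{0,0}=1$), and $f_{n,k}=0$ whenever $k<0$ or $t^k$ does not occur in $F_n(t)$. *)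

theory Defs
  imports
    "HOL-Combinatorics.Permutations"
    "HOL-Computational_Algebra.Polynomial"
begin

definition involutions :: "nat \<Rightarrow> (nat \<Rightarrow> nat) set" where
  "involutions n = {\<sigma>. \<sigma> permutes {1..n} \<and> \<sigma> \<circ> \<sigma> = id}"

definition ris :: "nat \<Rightarrow> (nat \<Rightarrow> nat) \<Rightarrow> nat" where
  "ris n \<sigma> = card {i. 1 \<le> i \<and> i < n \<and> \<sigma> i < \<sigma> (i + 1)}"

definition signed_eulerian_poly :: "nat \<Rightarrow> int poly" where
  "signed_eulerian_poly n = (\<Sum>\<sigma>\<in>involutions n. monom (sign \<sigma>) (ris n \<sigma>))"

text \<open>The second index is an integer, so that the shifted coefficients in the
  recurrence are genuinely zero (rather than truncated) at negative indices.\<close>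

definition signed_eulerian :: "nat \<Rightarrow> int \<Rightarrow> int" where
  "signed_eulerian n k = (if k < 0 then 0 else coeff (signed_eulerian_poly n) (nat k))"

end

theory Submission
  imports
    Defs
    "HOL-Library.Product_Lexorder"
    "HOL-Library.FuncSet"
    "HOL-Computational_Algebra.Formal_Power_Series"
begin

text \<open>
  The recurrence is a differential equation in disguise. For an involution $\sigma$ of
  $\{1,\dots,n\}$ consider the weakly increasing words $s_1 \le \dots \le s_n$ over an alphabet of
  $q$ letters that increase strictly wherever $\sigma$ does not rise. There are
  $\binom{q + \mathrm{ris}(\sigma)}{n}$ of them (\<open>card_compatible_words\<close>), so the signed number of
  pairs $(\sigma, s)$ is $A_n(q) = \sum_k f_{n,k} \binom{q+k}{n}$.

  On the other hand, replacing $i$ by the pair of letters $(s_i, s_{\sigma(i)})$ and counting how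
  often each pair occurs turns $(\sigma, s)$ into a symmetric $q \times q$ matrix of natural numbers
  with entry sum $n$. Since $\sigma$ is increasing on each block of equal letters, nothing is lost:
  the matrix together with the lexicographic order recovers $(\sigma, s)$, and every such matrix
  arises (\<open>entry_image\<close>, \<open>count_matrix_inj\<close>, \<open>count_matrix_surj\<close>). The fixed points of $\sigma$
  become the trace and its 2-cycles the entries on one side of the diagonal. Diagonal cells thus
  contribute 1 to the size and no sign, cells below the diagonal contribute 2 and a sign, and
  \[ \sum_n A_n(q) u^n = \frac{1}{(1-u)^q (1+u^2)^{q(q-1)/2}} . \]
  The logarithmic derivative of the right-hand side is rational in $u$, which gives a recurrence for
  $A_n(q)$ in $n$ of order 3 whose coefficients are quadratic polynomials in $q$
  (\<open>signed_matrix_count_recurrence\<close>).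

  It remains to compare coefficients: each product of a $\binom{q+k}{n-i}$ with its coefficient
  polynomial in $q$ is rewritten in terms of the $\binom{q+j}{n}$ (\<open>raise_binomial_1\<close>,
  \<open>raise_binomial_2\<close>, \<open>raise_binomial_3\<close>), and the polynomials $\binom{q+j}{n}$ with
  $0 \le j \le n$ are linearly independent (\<open>shifted_binomials_independent\<close>).
\<close>

section \<open>Words compatible with a permutation\<close>

definition compatible_words :: "nat \<Rightarrow> nat \<Rightarrow> (nat \<Rightarrow> nat) \<Rightarrow> (nat \<Rightarrow> nat) set" where
  "compatible_words n q \<sigma> = {s \<in> {1..n} \<rightarrow>\<^sub>E {..<q}.
     \<forall>i. 1 \<le> i \<and> i < n \<longrightarrow> s i \<le> s (i + 1) \<and> (\<not> \<sigma> i < \<sigma> (i + 1) \<longrightarrow> s i < s (i + 1))}"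

lemma finite_compatible_words: "finite (compatible_words n q \<sigma>)"
  by (rule finite_subset[of _ "{1..n} \<rightarrow>\<^sub>E {..<q}"])
     (auto simp: compatible_words_def intro: finite_PiE)

lemma compatible_words_mono:
  assumes s: "s \<in> compatible_words n q \<sigma>" and "1 \<le> i" "i \<le> j" "j \<le> n"
  shows "s i \<le> s j"
  using assms(3,4)
proof (induction j rule: dec_induct)
  case (step j)
  have "s j \<le> s (j + 1)"
    using s step \<open>1 \<le> i\<close> by (auto simp: compatible_words_def)
  with step show ?case by simp
qed simp

text \<open>
  Consecutive equal letters force a rise, so a permutation is increasing on every block of equal
  letters of a compatible word; this is what makes the words suitable for standardization.
\<close>

lemma compatible_words_increasing:
  assumes s: "s \<in> compatible_words n q \<sigma>" and "1 \<le> i" "i < j" "j \<le> n" and "s i = s j"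
  shows "\<sigma> i < \<sigma> j"
proof -
  have *: "\<sigma> k < \<sigma> (k + 1)" if "i \<le> k" "k < j" for k
  proof -
    have "s i \<le> s k" "s (k + 1) \<le> s j" "s k \<le> s (k + 1)"
      using compatible_words_mono[OF s] that assms(2,4) by simp_all
    then have "\<not> s k < s (k + 1)" using assms(5) by simp
    moreover have "\<not> \<sigma> k < \<sigma> (k + 1) \<longrightarrow> s k < s (k + 1)"
      using s that assms(2,4) by (simp add: compatible_words_def)
    ultimately show ?thesis by blast
  qed
  have "Suc i \<le> j" using \<open>i < j\<close> by simp
  then show ?thesis using *
  proof (induction j rule: dec_induct)
    case base
    then show ?case using base(1)[of i] by simp
  next
    case (step m)
    have "\<sigma> i < \<sigma> m" by (rule step.IH) (use step.prems in auto)
    also have "\<sigma> m < \<sigma> (m + 1)" using step.prems[of m] step.hyps by simp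
    finally show ?case by simp
  qed
qed

lemma ris_Suc:
  "ris (Suc n) \<sigma> = ris n \<sigma> + (if 1 \<le> n \<and> \<sigma> n < \<sigma> (n + 1) then 1 else 0)"
proof -
  have "{i. 1 \<le> i \<and> i < Suc n \<and> \<sigma> i < \<sigma> (i + 1)} =
        {i. 1 \<le> i \<and> i < n \<and> \<sigma> i < \<sigma> (i + 1)} \<union> (if 1 \<le> n \<and> \<sigma> n < \<sigma> (n + 1) then {n} else {})"
    by (auto simp: less_Suc_eq)
  then show ?thesis
    unfolding ris_def by (subst card_Un_disjoint | simp)+
qed

lemma ris_less: "n > 0 \<Longrightarrow> ris n \<sigma> < n"
proof (induction n)
  case (Suc n)
  then show ?case by (cases "n = 0") (auto simp: ris_Suc, simp_all add: ris_def)
qed simp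

text \<open>
  The words whose last letter is the largest one, $q$, are those whose remaining letters are at most
  $q$ if the last step is a rise, and smaller than $q$ otherwise. On the level of cardinalities this
  becomes Pascal's rule.
\<close>

lemma compatible_words_Suc_decomp:
  assumes "b = (if 1 \<le> n \<and> \<not> \<sigma> n < \<sigma> (n + 1) then q else Suc q)"
  shows "compatible_words (Suc n) (Suc q) \<sigma> =
    compatible_words (Suc n) q \<sigma> \<union> (\<lambda>s. s(Suc n := q)) ` compatible_words n b \<sigma>" (is "?L = ?R")
proof (intro equalityI subsetI)
  fix s assume s: "s \<in> ?L"
  show "s \<in> ?R"
  proof (cases "s (Suc n) = q")
    case False
    have "s i < q" if "i \<in> {1..Suc n}" for i
    proof -
      have "s i \<le> s (Suc n)" using compatible_words_mono[OF s] that by simp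
      moreover have "s (Suc n) < Suc q" using s by (auto simp: compatible_words_def PiE_def Pi_def)
      ultimately show ?thesis using False by simp
    qed
    then have "s \<in> compatible_words (Suc n) q \<sigma>"
      using s by (auto simp: compatible_words_def PiE_def Pi_def)
    then show ?thesis ..
  next
    case True
    define s' where "s' = s(Suc n := undefined)"
    have "s i < b" if "i \<in> {1..n}" for i
    proof -
      have "s i \<le> s n" using compatible_words_mono[OF s] that by simp
      moreover have "s n \<le> s (n+1)" "\<not> \<sigma> n < \<sigma> (n + 1) \<longrightarrow> s n < s (n + 1)"
        using that s by (auto simp: compatible_words_def)
      ultimately show ?thesis using True that assms by auto
    qed
    then have "s' \<in> compatible_words n b \<sigma>"
      using s by (auto simp: compatible_words_def PiE_def Pi_def s'_def extensional_def)
    moreover have "s = s'(Suc n := q)" using True by (auto simp: s'_def)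
    ultimately show ?thesis by blast
  qed
next
  fix s assume "s \<in> ?R"
  then consider "s \<in> compatible_words (Suc n) q \<sigma>"
    | s' where "s' \<in> compatible_words n b \<sigma>" "s = s'(Suc n := q)" by blast
  then show "s \<in> ?L"
  proof cases
    case 1
    then show ?thesis by (auto simp: compatible_words_def PiE_def Pi_def less_Suc_eq)
  next
    case 2
    have B: "s' i < b" if "1 \<le> i" "i \<le> n" for i
      using 2 that by (auto simp: compatible_words_def PiE_def Pi_def)
    have "b \<le> Suc q" using assms by auto
    have "s i \<le> s (i + 1) \<and> (\<not> \<sigma> i < \<sigma> (i + 1) \<longrightarrow> s i < s (i + 1))"
      if "1 \<le> i" "i < Suc n" for i
    proof (cases "i = n")
      case True
      then show ?thesis using B[of n] that assms 2 by (auto split: if_splits)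
    next
      case False
      then show ?thesis using 2 that by (auto simp: compatible_words_def)
    qed
    moreover have "s \<in> {1..Suc n} \<rightarrow>\<^sub>E {..<Suc q}"
      using 2 B \<open>b \<le> Suc q\<close>
      by (fastforce simp: compatible_words_def PiE_def Pi_def extensional_def)
    ultimately show ?thesis by (simp add: compatible_words_def)
  qed
qed

text \<open>
  Whether the last letter may repeat its predecessor or not, one of the two sides of Pascal's rule for
  $\binom{q + 1 + \mathrm{ris}}{n + 1}$ is supplied by the words that use the new letter. In the case
  $q = 0$ with $n > 0$ the binomial coefficient vanishes because there are fewer than $n$ rises.
\<close>

lemma card_compatible_words: "card (compatible_words n q \<sigma>) = (q + ris n \<sigma>) choose n"
proof (induction n arbitrary: q)
  case 0
  have "compatible_words 0 q \<sigma> = {\<lambda>_. undefined}"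
    by (auto simp: compatible_words_def)
  then show ?case by simp
next
  case (Suc n)
  note IH = Suc.IH
  show ?case
  proof (induction q)
    case 0
    have "compatible_words (Suc n) 0 \<sigma> = {}"
      by (auto simp: compatible_words_def PiE_def Pi_def)
    then show ?case using ris_less[of "Suc n" \<sigma>] by (simp add: binomial_eq_0)
  next
    case (Suc q)
    \<comment> \<open>The number of letters available for the first n positions when the last letter is q.\<close>
    define b where "b = (if 1 \<le> n \<and> \<not> \<sigma> n < \<sigma> (n + 1) then q else Suc q)"
    have "compatible_words (Suc n) q \<sigma> \<inter> (\<lambda>s. s(Suc n := q)) ` compatible_words n b \<sigma> = {}"
      by (auto simp: compatible_words_def PiE_def Pi_def)
    moreover have "inj_on (\<lambda>s. s(Suc n := q)) (compatible_words n b \<sigma>)"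
    proof (rule inj_onI)
      fix s t assume "s \<in> compatible_words n b \<sigma>" "t \<in> compatible_words n b \<sigma>"
        and eq: "s(Suc n := q) = t(Suc n := q)"
      then have "s (Suc n) = t (Suc n)"
        by (auto simp: compatible_words_def PiE_def extensional_def)
      with eq show "s = t" by (metis fun_upd_triv fun_upd_upd)
    qed
    ultimately have "card (compatible_words (Suc n) (Suc q) \<sigma>) =
        (q + ris (Suc n) \<sigma> choose Suc n) + (b + ris n \<sigma> choose n)"
      by (simp add: compatible_words_Suc_decomp[OF b_def] card_Un_disjoint finite_compatible_words
          card_image IH Suc)
    moreover have "b + ris n \<sigma> choose n = q + ris (Suc n) \<sigma> choose n"
      by (cases "n = 0") (auto simp: b_def ris_Suc)
    ultimately show ?case by simp
  qed
qed

section \<open>Arrays of natural numbers with a given weighted sum\<close>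

definition arrays :: "'a set \<Rightarrow> ('a \<Rightarrow> nat) \<Rightarrow> nat \<Rightarrow> ('a \<Rightarrow> nat) set" where
  "arrays T w n = {M. (\<forall>p. p \<notin> T \<longrightarrow> M p = 0) \<and> (\<Sum>p\<in>T. w p * M p) = n}"

text \<open>
  The generating function of the arrays on the cells \<open>T\<close> by their \<open>w\<close>-weighted sum, where each unit
  in cell \<open>p\<close> contributes a factor \<open>c p\<close>.
\<close>

definition arrays_fps :: "'a set \<Rightarrow> ('a \<Rightarrow> nat) \<Rightarrow> ('a \<Rightarrow> int) \<Rightarrow> int fps" where
  "arrays_fps T w c = Abs_fps (\<lambda>n. \<Sum>M\<in>arrays T w n. \<Prod>p\<in>T. c p ^ M p)"

lemma finite_arrays:
  assumes "finite T" "\<And>p. p \<in> T \<Longrightarrow> w p > 0"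
  shows "finite (arrays T w n)"
proof (rule finite_subset)
  show "finite {M. \<forall>p. (p \<in> T \<longrightarrow> M p \<in> {..n}) \<and> (p \<notin> T \<longrightarrow> M p = 0)}"
    by (rule finite_set_of_finite_funs) (use assms in auto)
  have "M p \<le> (\<Sum>p\<in>T. w p * M p)" if "p \<in> T" for M :: "'a \<Rightarrow> nat" and p
  proof -
    have "M p \<le> w p * M p" using assms(2)[OF that] by simp
    also have "\<dots> \<le> (\<Sum>p\<in>T. w p * M p)"
      by (rule member_le_sum) (use assms that in auto)
    finally show ?thesis .
  qed
  then show "arrays T w n \<subseteq> {M. \<forall>p. (p \<in> T \<longrightarrow> M p \<in> {..n}) \<and> (p \<notin> T \<longrightarrow> M p = 0)}"
    by (auto simp: arrays_def)
qed

text \<open>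
  An array on one more cell either vanishes there or arises by adding one unit to that cell. This
  avoids inverting the geometric series $1/(1 - c_p X^{w_p})$ and works over the integers.
\<close>

lemma arrays_insert:
  assumes "finite T" "p \<notin> T"
  shows "arrays (insert p T) w n = arrays T w n \<union>
    (if w p \<le> n then (\<lambda>M. M(p := Suc (M p))) ` arrays (insert p T) w (n - w p) else {})"
    (is "?L = ?R")
proof (intro equalityI subsetI)
  fix M assume M: "M \<in> ?L"
  show "M \<in> ?R"
  proof (cases "M p")
    case 0
    then have "M x = 0" if "x \<notin> T" for x
      using M that by (cases "x = p") (auto simp: arrays_def)
    then have "M \<in> arrays T w n" using M 0 assms by (simp add: arrays_def)
    then show ?thesis ..
  next
    case (Suc m)
    define M' where "M' = M(p := m)"
    have *: "(\<Sum>x\<in>T. w x * M' x) = (\<Sum>x\<in>T. w x * M x)"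
      by (rule sum.cong) (use assms in \<open>auto simp: M'_def\<close>)
    have "w p \<le> n" "M' \<in> arrays (insert p T) w (n - w p)"
      using M Suc assms * by (auto simp: arrays_def M'_def)
    moreover have "M = M'(p := Suc (M' p))" using Suc by (auto simp: M'_def)
    ultimately show ?thesis by auto
  qed
next
  fix M assume "M \<in> ?R"
  then consider "M \<in> arrays T w n"
    | M' where "w p \<le> n" "M' \<in> arrays (insert p T) w (n - w p)" "M = M'(p := Suc (M' p))"
    by (auto split: if_splits)
  then show "M \<in> ?L"
  proof cases
    case 1
    then show ?thesis using assms by (auto simp: arrays_def)
  next
    case 2
    have "(\<Sum>x\<in>T. w x * M' x) = (\<Sum>x\<in>T. w x * M x)"
      by (rule sum.cong) (use assms 2 in auto)
    then show ?thesis using assms 2 by (auto simp: arrays_def)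
  qed
qed

lemma arrays_fps_insert:
  assumes "finite T" "p \<notin> T" "\<And>x. x \<in> insert p T \<Longrightarrow> w x > 0"
  shows "arrays_fps (insert p T) w c * (1 - fps_const (c p) * fps_X ^ w p) = arrays_fps T w c"
proof (rule fps_ext)
  fix n
  let ?f = "\<lambda>T M. \<Prod>x\<in>T. c x ^ (M x :: nat)"
  let ?up = "\<lambda>M. M(p := Suc (M p))"
  let ?S = "\<lambda>n. \<Sum>M\<in>arrays (insert p T) w n. ?f (insert p T) M"
  have fin: "finite (arrays T w n)" for n
    by (rule finite_arrays) (use assms in auto)
  have fin': "finite (arrays (insert p T) w n)" for n
    by (rule finite_arrays) (use assms in auto)
  have up: "?f (insert p T) (?up M) = c p * ?f (insert p T) M" for M
  proof -
    have "?f T (?up M) = ?f T M" by (rule prod.cong) (use assms in auto)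
    then show ?thesis using assms by simp
  qed
  have inj: "inj_on ?up A" for A
    by (rule inj_onI) (metis fun_upd_same fun_upd_triv fun_upd_upd nat.inject)
  have zero: "?f (insert p T) M = ?f T M" if "M \<in> arrays T w n" for M
    using that assms by (auto simp: arrays_def)
  have "?S n = (\<Sum>M\<in>arrays T w n. ?f T M) + (if w p \<le> n then c p * ?S (n - w p) else 0)"
  proof (cases "w p \<le> n")
    case True
    have "arrays T w n \<inter> ?up ` arrays (insert p T) w (n - w p) = {}"
      using assms by (auto simp: arrays_def)
    then have "?S n = (\<Sum>M\<in>arrays T w n. ?f (insert p T) M)
        + (\<Sum>M\<in>?up ` arrays (insert p T) w (n - w p). ?f (insert p T) M)"
      using True fin fin' by (subst arrays_insert) (simp_all add: assms sum.union_disjoint)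
    also have "(\<Sum>M\<in>?up ` arrays (insert p T) w (n - w p). ?f (insert p T) M) = c p * ?S (n - w p)"
      by (simp only: sum.reindex[OF inj] o_def up sum_distrib_left)
    also have "(\<Sum>M\<in>arrays T w n. ?f (insert p T) M) = (\<Sum>M\<in>arrays T w n. ?f T M)"
      by (rule sum.cong) (simp_all add: zero)
    finally show ?thesis using True by simp
  next
    case False
    then have "arrays (insert p T) w n = arrays T w n"
      by (simp add: arrays_insert assms)
    then show ?thesis using False by (simp add: zero cong: sum.cong)
  qed
  moreover have "arrays_fps (insert p T) w c * (1 - fps_const (c p) * fps_X ^ w p) =
      arrays_fps (insert p T) w c - fps_const (c p) * (fps_X ^ w p * arrays_fps (insert p T) w c)"
    by (simp add: algebra_simps)
  ultimately show "fps_nth (arrays_fps (insert p T) w c * (1 - fps_const (c p) * fps_X ^ w p)) n =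
      fps_nth (arrays_fps T w c) n"
    by (simp add: arrays_fps_def fps_X_power_mult_nth)
qed

lemma arrays_fps_mult_prod:
  assumes "finite T" "\<And>x. x \<in> T \<Longrightarrow> w x > 0"
  shows "arrays_fps T w c * (\<Prod>p\<in>T. 1 - fps_const (c p) * fps_X ^ w p) = 1"
  using assms
proof (induction T rule: finite_induct)
  case empty
  have "arrays {} w n = (if n = 0 then {\<lambda>_. 0} else {})" for n
    by (auto simp: arrays_def)
  then show ?case by (auto simp: arrays_fps_def fps_eq_iff)
next
  case (insert p T)
  have "arrays_fps (insert p T) w c * (1 - fps_const (c p) * fps_X ^ w p) = arrays_fps T w c"
    by (rule arrays_fps_insert) (use insert in auto)
  then show ?case
    using insert by (simp add: mult.assoc[symmetric])
qed

section \<open>Signed symmetric matrices\<close>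

text \<open>
  A symmetric matrix is represented by its entries on and below the diagonal. A cell below the
  diagonal stands for two entries of the matrix, hence the weight 2; a unit in it corresponds to a
  2-cycle, hence the sign.
\<close>

definition cells :: "nat \<Rightarrow> (nat \<times> nat) set" where
  "cells q = (SIGMA b:{..<q}. {..b})"

definition cell_weight :: "nat \<times> nat \<Rightarrow> nat" where
  "cell_weight = (\<lambda>(b, a). if a = b then 1 else 2)"

definition cell_sign :: "nat \<times> nat \<Rightarrow> int" where
  "cell_sign = (\<lambda>(b, a). if a = b then 1 else - 1)"

definition signed_matrix_count :: "nat \<Rightarrow> nat \<Rightarrow> int" where
  "signed_matrix_count q n =
     (\<Sum>M\<in>arrays (cells q) cell_weight n. \<Prod>p\<in>cells q. cell_sign p ^ M p)"

lemma finite_cells [simp]: "finite (cells q)"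
  by (simp add: cells_def)

lemma cell_weight_pos: "cell_weight p > 0"
  by (cases p) (simp add: cell_weight_def)

lemma logarithmic_derivative_prod:
  fixes P :: "'a \<Rightarrow> int fps"
  assumes "finite T" "\<And>p. p \<in> T \<Longrightarrow> V * fps_deriv (P p) = L p * P p"
  shows "V * fps_deriv (\<Prod>p\<in>T. P p) = (\<Sum>p\<in>T. L p) * (\<Prod>p\<in>T. P p)"
  using assms
proof (induction T rule: finite_induct)
  case (insert p T)
  have "V * fps_deriv (\<Prod>p\<in>insert p T. P p) =
      P p * (V * fps_deriv (\<Prod>p\<in>T. P p)) + (V * fps_deriv (P p)) * (\<Prod>p\<in>T. P p)"
    using insert.hyps by (simp add: algebra_simps)
  then show ?case using insert by (simp add: algebra_simps)
qed simp

text \<open>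
  By \<open>arrays_fps_mult_prod\<close> the series is the inverse of a product of factors $1 - X$ and
  $1 + X^2$. Multiplication by $V = (1 - X)(1 + X^2)$ clears the denominators of the logarithmic
  derivatives of all of these factors.
\<close>

lemma signed_matrix_count_ode:
  fixes q :: nat
  defines "A \<equiv> Abs_fps (signed_matrix_count q)"
  shows "(1 - fps_X) * (1 + fps_X ^ 2) * fps_deriv A =
    (of_nat q * (1 + fps_X ^ 2) - of_nat q * (of_nat q - 1) * (fps_X * (1 - fps_X))) * A"
proof -
  define V L P where "V = (1 - fps_X) * (1 + fps_X ^ 2 :: int fps)"
    and "L = (\<lambda>(b, a :: nat). if a = b then - (1 + fps_X ^ 2) else 2 * (fps_X * (1 - fps_X)) :: int fps)"
    and "P = (\<lambda>p :: nat \<times> nat. 1 - fps_const (cell_sign p) * fps_X ^ cell_weight p)"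
  define D where "D = (\<Prod>p\<in>cells q. P p)"
  have "A = arrays_fps (cells q) cell_weight cell_sign"
    by (simp add: A_def arrays_fps_def signed_matrix_count_def[abs_def])
  then have AD: "A * D = 1"
    unfolding D_def P_def by (simp add: arrays_fps_mult_prod cell_weight_pos)
  have P: "P (b, a) = (if a = b then 1 - fps_X else 1 + fps_X ^ 2)" for a b
    by (simp add: P_def cell_sign_def cell_weight_def flip: fps_const_neg)
  have "V * fps_deriv (P p) = L p * P p" for p
    by (cases p) (simp add: P L_def V_def fps_deriv_power numeral_fps_const algebra_simps)
  then have "V * fps_deriv D = (\<Sum>p\<in>cells q. L p) * D"
    unfolding D_def by (intro logarithmic_derivative_prod) auto
  also have "(\<Sum>p\<in>cells q. L p) =
      of_nat q * (of_nat q - 1) * (fps_X * (1 - fps_X)) - of_nat q * (1 + fps_X ^ 2)"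
  proof -
    have row: "(\<Sum>a\<le>b. L (b, a)) = of_nat b * (2 * (fps_X * (1 - fps_X))) - (1 + fps_X ^ 2)" for b
    proof -
      have "(\<Sum>a\<le>b. L (b, a)) = (\<Sum>a<b. L (b, a)) + L (b, b)"
        by (simp add: lessThan_Suc_atMost[symmetric])
      also have "(\<Sum>a<b. L (b, a)) = (\<Sum>a<b. 2 * (fps_X * (1 - fps_X)))"
        by (rule sum.cong) (auto simp: L_def)
      finally show ?thesis by (simp add: L_def)
    qed
    have "(\<Sum>p\<in>cells q. L p) = (\<Sum>b<q. \<Sum>a\<le>b. L (b, a))"
      by (simp add: cells_def sum.Sigma)
    also have "\<dots> = of_nat q * (of_nat q - 1) * (fps_X * (1 - fps_X)) - of_nat q * (1 + fps_X ^ 2)"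
      unfolding row by (induction q) (simp_all add: algebra_simps)
    finally show ?thesis .
  qed
  finally have VD: "V * fps_deriv D = \<dots> * D" .
  have "fps_deriv A * D = - (A * fps_deriv D)"
    using arg_cong[OF AD, of fps_deriv] by (simp add: add_eq_0_iff)
  then have "V * (fps_deriv A * D) = - (A * (V * fps_deriv D))"
    by (simp add: algebra_simps)
  then have "V * fps_deriv A * D = - (A * (V * fps_deriv D))"
    by (simp only: mult.assoc)
  also have "\<dots> = (of_nat q * (1 + fps_X ^ 2) - of_nat q * (of_nat q - 1) * (fps_X * (1 - fps_X))) * A * D"
    unfolding VD by (simp add: algebra_simps)
  finally show ?thesis
    using AD unfolding V_def by (metis mult_cancel_right mult_zero_right zero_neq_one)
qed

lemma signed_matrix_count_recurrence:
  fixes q m :: nat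
  defines "A \<equiv> signed_matrix_count q" and "x \<equiv> int q"
  shows "int (m + 3) * A (m + 3) = (int m + 2 + x) * A (m + 2)
    - (int m + 1 + x * (x - 1)) * A (m + 1) + (int m + x ^ 2) * A m"
proof -
  let ?F = "Abs_fps A"
  have lhs: "((1 - fps_X) * (1 + fps_X ^ 2) * fps_deriv ?F) =
      fps_deriv ?F - fps_X * fps_deriv ?F + fps_X ^ 2 * fps_deriv ?F - fps_X ^ 3 * fps_deriv ?F"
    by (simp add: algebra_simps power2_eq_square power3_eq_cube)
  have rhs: "(of_nat q * (1 + fps_X ^ 2) - of_nat q * (of_nat q - 1) * (fps_X * (1 - fps_X))) * ?F =
     fps_const x * ?F - fps_const (x * (x - 1)) * (fps_X * ?F)
     + fps_const (x ^ 2) * (fps_X ^ 2 * ?F)"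
    by (simp add: x_def fps_of_nat[symmetric] algebra_simps power2_eq_square
        flip: fps_const_sub fps_const_mult fps_const_add)
  have "fps_nth (fps_deriv ?F - fps_X * fps_deriv ?F + fps_X ^ 2 * fps_deriv ?F
        - fps_X ^ 3 * fps_deriv ?F) (m + 2)
      = fps_nth (fps_const x * ?F - fps_const (x * (x - 1)) * (fps_X * ?F)
         + fps_const (x ^ 2) * (fps_X ^ 2 * ?F)) (m + 2)"
    using arg_cong[OF signed_matrix_count_ode[of q], of "\<lambda>F. fps_nth F (m + 2)"]
    by (simp only: A_def[symmetric] lhs rhs)
  then show ?thesis
    by (cases m) (simp_all add: fps_X_power_mult_nth algebra_simps numeral_eq_Suc)
qed

section \<open>Signs of involutions\<close>

lemma finite_involutions: "finite (involutions n)"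
  by (rule finite_subset[of _ "{\<sigma>. \<sigma> permutes {1..n}}"])
     (auto simp: involutions_def intro: finite_permutations)

lemma involutions_twice:
  assumes "\<sigma> \<in> involutions n"
  shows "\<sigma> (\<sigma> i) = i"
proof -
  have "(\<sigma> \<circ> \<sigma>) i = id i" using assms by (simp add: involutions_def)
  then show ?thesis by simp
qed

lemma permutes_descents_subset:
  fixes \<sigma> :: "nat \<Rightarrow> nat"
  assumes "\<sigma> permutes S"
  shows "{i. \<sigma> i < i} \<subseteq> S"
  using permutes_not_in[OF assms] by (metis (mono_tags) less_irrefl mem_Collect_eq subsetI)

text \<open>
  Each 2-cycle of an involution has exactly one element that is mapped to a smaller one. The induction
  removes one 2-cycle by composing with the corresponding transposition.
\<close>

lemma sign_involution:
  assumes "\<sigma> \<in> involutions n"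
  shows "sign \<sigma> = (- 1) ^ card {i. \<sigma> i < i}"
  using assms
proof (induction "card {i. \<sigma> i < i}" arbitrary: \<sigma>)
  case 0
  have fin: "finite {i. \<sigma> i < i}"
    by (rule finite_subset[OF permutes_descents_subset[of \<sigma> "{1..n}"]])
       (use "0.prems" in \<open>simp_all add: involutions_def\<close>)
  have inv: "\<sigma> (\<sigma> i) = i" for i
    by (rule involutions_twice[OF "0.prems"])
  have empty: "\<not> \<sigma> i < i" for i
    using 0 fin by auto
  have "\<sigma> i = i" for i
    using empty[of i] empty[of "\<sigma> i"] inv[of i] by simp
  then have "\<sigma> = id" by auto
  then show ?case by (simp add: sign_id)
next
  case (Suc m)
  have perm: "\<sigma> permutes {1..n}" using Suc.prems by (simp add: involutions_def)
  have inv: "\<sigma> (\<sigma> i) = i" for i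
    by (rule involutions_twice[OF Suc.prems])
  have "{i. \<sigma> i < i} \<noteq> {}" using Suc.hyps(2) by (metis card.empty nat.distinct(1))
  then obtain i where i: "\<sigma> i < i" by auto
  then have i_in: "i \<in> {1..n}" "\<sigma> i \<in> {1..n}"
    using permutes_descents_subset[OF perm] permutes_in_image[OF perm, of i] by blast+
  define \<tau> where "\<tau> = \<sigma> \<circ> transpose i (\<sigma> i)"
  have \<tau>: "\<tau> j = (if j = i \<or> j = \<sigma> i then j else \<sigma> j)" for j
    by (auto simp: \<tau>_def transpose_def inv)
  have "\<tau> permutes {1..n}"
    unfolding \<tau>_def by (intro permutes_compose permutes_swap_id i_in perm)
  moreover have "\<tau> (\<tau> j) = j" for j
  proof (cases "j = i \<or> j = \<sigma> i")
    case False
    then have "\<sigma> j \<noteq> i" "\<sigma> j \<noteq> \<sigma> i" by (metis inv)+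
    with False show ?thesis by (simp add: \<tau> inv)
  qed (auto simp: \<tau>)
  ultimately have mem: "\<tau> \<in> involutions n" by (auto simp: involutions_def)
  have set: "{j. \<tau> j < j} = {j. \<sigma> j < j} - {i}"
    using i by (auto simp: \<tau> inv)
  have fin: "finite {i. \<sigma> i < i}"
    using Suc.hyps(2) by (metis card.infinite nat.distinct(1))
  have card: "card {j. \<tau> j < j} = m"
    using i fin Suc.hyps(2) by (simp add: set)
  have "sign \<tau> = - sign \<sigma>"
    unfolding \<tau>_def using i perm
    by (subst sign_compose[OF permutation_permutes[THEN iffD2] permutation_swap_id])
       (blast, simp add: sign_swap_id)
  moreover have "sign \<tau> = (- 1) ^ m"
    using Suc.hyps(1)[of \<tau>] card mem by simp
  ultimately have "sign \<sigma> = - ((- 1) ^ m)" by linarith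
  then show ?case by (simp add: Suc.hyps(2)[symmetric])
qed

section \<open>Enumerating finite sets in increasing order\<close>

lemma rank_image:
  fixes C :: "nat set"
  assumes "finite C"
  shows "(\<lambda>i. card {j \<in> C. j < i}) ` C = {..<card C}"
proof (rule card_subset_eq)
  have less: "card {j \<in> C. j < i} < card {j \<in> C. j < k}" if "i \<in> C" "i < k" for i k
    by (rule psubset_card_mono) (use that assms in auto)
  have "inj_on (\<lambda>i. card {j \<in> C. j < i}) C"
    by (rule linorder_inj_onI') (use less in force)
  then show "card ((\<lambda>i. card {j \<in> C. j < i}) ` C) = card {..<card C}"
    by (simp add: card_image)
  have "card {j \<in> C. j < i} < card C" if "i \<in> C" for i
    by (rule psubset_card_mono) (use that assms in auto)
  then show "(\<lambda>i. card {j \<in> C. j < i}) ` C \<subseteq> {..<card C}" by auto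
qed simp

lemma strict_mono_on_interval_unique:
  fixes f g :: "nat \<Rightarrow> 'a :: linorder"
  assumes "strict_mono_on {1..n} f" "strict_mono_on {1..n} g" "f ` {1..n} = g ` {1..n}" "i \<in> {1..n}"
  shows "f i = g i"
proof -
  have sorted: "sorted_wrt (<) (map h [1..<Suc n])" if "strict_mono_on {1..n} h" for h :: "nat \<Rightarrow> 'a"
    using that by (auto simp: sorted_wrt_iff_nth_less strict_mono_on_def simp del: upt_Suc)
  have "set (map h [1..<Suc n]) = h ` {1..n}" for h :: "nat \<Rightarrow> 'a"
    by (auto simp del: upt_Suc)
  then have "map f [1..<Suc n] = map g [1..<Suc n]"
    by (intro strict_sorted_equal sorted assms(1,2)) (simp only: assms(3))
  then show ?thesis using assms(4) by (simp del: upt_Suc)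
qed

lemma strict_mono_on_interval_exists:
  fixes E :: "'a :: linorder set"
  assumes "finite E"
  obtains f where "strict_mono_on {1..card E} f" "f ` {1..card E} = E"
proof
  let ?f = "\<lambda>i. sorted_list_of_set E ! (i - 1)"
  show "strict_mono_on {1..card E} ?f"
    by (auto simp: strict_mono_on_def intro!: sorted_wrt_nth_less[where P = "(<)"])
  have "(\<lambda>i. i - 1) ` {1..card E} = {..<card E}"
  proof -
    have "x \<in> (\<lambda>i. i - 1) ` {1..card E}" if "x < card E" for x
      by (rule image_eqI[of _ _ "Suc x"]) (use that in auto)
    then show ?thesis by auto
  qed
  then have "?f ` {1..card E} = (!) (sorted_list_of_set E) ` {..<card E}"
    by (metis (no_types) image_image)
  also have "\<dots> = set (sorted_list_of_set E)"
    by (auto simp: set_conv_nth)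
  finally show "?f ` {1..card E} = E" using assms by simp
qed

lemma sum_card_fibres:
  assumes "finite S" "finite T" "g ` S \<subseteq> T"
  shows "(\<Sum>y\<in>T. card {x \<in> S. g x = y}) = card S"
  using sum.group[OF assms, of "\<lambda>_. 1::nat"] by simp

section \<open>Involutions with compatible words are symmetric matrices\<close>

lemma sum_symmetric:
  fixes g :: "nat \<times> nat \<Rightarrow> nat"
  shows "(\<Sum>a<q. \<Sum>b<q. g (max a b, min a b)) = (\<Sum>p\<in>cells q. cell_weight p * g p)"
proof -
  have row: "(\<Sum>a\<le>b. cell_weight (b, a) * g (b, a)) = 2 * (\<Sum>a<b. g (b, a)) + g (b, b)" for b
  proof -
    have "(\<Sum>a<b. cell_weight (b, a) * g (b, a)) = 2 * (\<Sum>a<b. g (b, a))"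
      unfolding sum_distrib_left by (rule sum.cong) (auto simp: cell_weight_def)
    then show ?thesis
      by (simp add: lessThan_Suc_atMost[symmetric] cell_weight_def)
  qed
  have "(\<Sum>p\<in>cells q. cell_weight p * g p) = (\<Sum>b<q. \<Sum>a\<le>b. cell_weight (b, a) * g (b, a))"
    by (simp add: cells_def sum.Sigma)
  also have "\<dots> = (\<Sum>a<q. \<Sum>b<q. g (max a b, min a b))"
    unfolding row
  proof (induction q)
    case (Suc q)
    have "(\<Sum>a<q. g (max a q, min a q)) = (\<Sum>a<q. g (q, a))"
         "(\<Sum>a<q. g (max q a, min q a)) = (\<Sum>a<q. g (q, a))"
      by (auto intro!: sum.cong simp: max_def min_def)
    then show ?case using Suc by (simp add: sum.distrib)
  qed simp
  finally show ?thesis ..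
qed

text \<open>
  The matrix as a multiset of positions, made into a set by numbering the units within each entry.
  Its size is the entry sum of the matrix, and the lexicographic order on it is the order in which
  standardization numbers its elements.
\<close>

definition entries :: "nat \<Rightarrow> (nat \<times> nat \<Rightarrow> nat) \<Rightarrow> (nat \<times> nat \<times> nat) set" where
  "entries q M = (SIGMA a:{..<q}. SIGMA b:{..<q}. {..<M (max a b, min a b)})"

lemma finite_entries [simp]: "finite (entries q M)"
  by (simp add: entries_def)

lemma card_entries: "card (entries q M) = (\<Sum>p\<in>cells q. cell_weight p * M p)"
  by (simp add: entries_def sum_symmetric)

definition transpose_entry :: "nat \<times> nat \<times> nat \<Rightarrow> nat \<times> nat \<times> nat" where
  "transpose_entry = (\<lambda>(a, b, k). (b, a, k))"

text \<open>
  The unit of the matrix that comes from the index \<open>i\<close>: the last component is the rank of \<open>i\<close> among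
  all indices with the same pair of letters.
\<close>

definition entry :: "nat \<Rightarrow> (nat \<Rightarrow> nat) \<Rightarrow> (nat \<Rightarrow> nat) \<Rightarrow> nat \<Rightarrow> nat \<times> nat \<times> nat" where
  "entry n \<sigma> s i =
     (s i, s (\<sigma> i), card {j \<in> {1..n}. j < i \<and> s j = s i \<and> s (\<sigma> j) = s (\<sigma> i)})"

text \<open>
  A cell \<open>(b, a)\<close> with $a < b$ counts the 2-cycles joining the blocks of letters \<open>a\<close> and \<open>b\<close>, a
  diagonal cell the fixed points in its block: an increasing involution of the indices that stay in a
  block is the identity.
\<close>

definition count_matrix :: "nat \<Rightarrow> nat \<Rightarrow> (nat \<Rightarrow> nat) \<Rightarrow> (nat \<Rightarrow> nat) \<Rightarrow> nat \<times> nat \<Rightarrow> nat" where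
  "count_matrix n q \<sigma> s =
     (\<lambda>(b, a). if (b, a) \<in> cells q then card {i \<in> {1..n}. s i = b \<and> s (\<sigma> i) = a} else 0)"

context
  fixes n q :: nat and \<sigma> s :: "nat \<Rightarrow> nat"
  assumes \<sigma>: "\<sigma> \<in> involutions n" and s: "s \<in> compatible_words n q \<sigma>"
begin

private lemma inv: "\<sigma> (\<sigma> i) = i"
  by (rule involutions_twice[OF \<sigma>])

private lemma mem: "\<sigma> i \<in> {1..n} \<longleftrightarrow> i \<in> {1..n}"
  using \<sigma> permutes_in_image[of \<sigma> "{1..n}"] by (simp only: involutions_def mem_Collect_eq)

private lemma less: "i \<in> {1..n} \<Longrightarrow> s i < q"
  using s by (auto simp: compatible_words_def PiE_def Pi_def)

private lemma mono: "i \<in> {1..n} \<Longrightarrow> j \<in> {1..n} \<Longrightarrow> i \<le> j \<Longrightarrow> s i \<le> s j"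
  using compatible_words_mono[OF s] by simp

private lemma incr: "i \<in> {1..n} \<Longrightarrow> j \<in> {1..n} \<Longrightarrow> i < j \<Longrightarrow> s i = s j \<Longrightarrow> \<sigma> i < \<sigma> j"
  using compatible_words_increasing[OF s] by simp

text \<open>
  The first letters increase weakly because \<open>s\<close> does, and where they agree the second letters
  increase weakly because \<open>\<sigma>\<close> is increasing on the block. Together with \<open>entry_image\<close> this identifies
  \<open>entry\<close> as the increasing enumeration of the units of the matrix.
\<close>

lemma strict_mono_entry: "strict_mono_on {1..n} (entry n \<sigma> s)"
proof (rule strict_mono_onI)
  fix i j assume ij: "i \<in> {1..n}" "j \<in> {1..n}" "i < j"
  show "entry n \<sigma> s i < entry n \<sigma> s j"
  proof (cases "s i = s j")
    case False
    then show ?thesis using mono[of i j] ij by (simp add: entry_def)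
  next
    case True
    then have "\<sigma> i < \<sigma> j" using incr ij by blast
    then have le: "s (\<sigma> i) \<le> s (\<sigma> j)" 
      using mono[OF iffD2[OF mem ij(1)] iffD2[OF mem ij(2)]] by simp
    show ?thesis
    proof (cases "s (\<sigma> i) = s (\<sigma> j)")
      case False
      then show ?thesis using le True by (simp add: entry_def)
    next
      case eq: True
      have "card {k \<in> {1..n}. k < i \<and> s k = s i \<and> s (\<sigma> k) = s (\<sigma> i)} <
            card {k \<in> {1..n}. k < j \<and> s k = s j \<and> s (\<sigma> k) = s (\<sigma> j)}" (is "card ?A < card ?B")
      proof (rule psubset_card_mono)
        have "?A \<subseteq> ?B"
          unfolding True eq using less_trans[OF _ ij(3)] by blast
        moreover have "i \<in> ?B" "i \<notin> ?A"
          using True eq ij by blast+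
        ultimately show "?A \<subset> ?B" by blast
      qed simp
      then show ?thesis using True eq by (simp add: entry_def)
    qed
  qed
qed

text \<open>
  Passing from \<open>i\<close> to \<open>\<sigma> i\<close> exchanges the two letters. It preserves the rank, since \<open>\<sigma>\<close> maps the
  indices counted for \<open>i\<close> increasingly onto those counted for \<open>\<sigma> i\<close>.
\<close>

lemma entry_involution:
  assumes i: "i \<in> {1..n}"
  shows "entry n \<sigma> s (\<sigma> i) = transpose_entry (entry n \<sigma> s i)"
proof -
  have "bij_betw \<sigma> {j \<in> {1..n}. j < i \<and> s j = s i \<and> s (\<sigma> j) = s (\<sigma> i)}
      {j \<in> {1..n}. j < \<sigma> i \<and> s j = s (\<sigma> i) \<and> s (\<sigma> j) = s (\<sigma> (\<sigma> i))}"
  proof (rule bij_betw_byWitness[where f' = \<sigma>])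
    have "\<sigma> j < \<sigma> i" if "j \<in> {1..n}" "j < i" "s j = s i" for j
      using incr i that by blast
    then show "\<sigma> ` {j \<in> {1..n}. j < i \<and> s j = s i \<and> s (\<sigma> j) = s (\<sigma> i)}
        \<subseteq> {j \<in> {1..n}. j < \<sigma> i \<and> s j = s (\<sigma> i) \<and> s (\<sigma> j) = s (\<sigma> (\<sigma> i))}"
      by (auto simp: inv mem simp del: atLeastAtMost_iff One_nat_def)
    have "\<sigma> j < i" if "j \<in> {1..n}" "j < \<sigma> i" "s j = s (\<sigma> i)" for j
      using incr[of j "\<sigma> i"] i that mem[of i] inv[of i] by (simp only: simp_thms)
    then show "\<sigma> ` {j \<in> {1..n}. j < \<sigma> i \<and> s j = s (\<sigma> i) \<and> s (\<sigma> j) = s (\<sigma> (\<sigma> i))}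
        \<subseteq> {j \<in> {1..n}. j < i \<and> s j = s i \<and> s (\<sigma> j) = s (\<sigma> i)}"
      by (auto simp: inv mem simp del: atLeastAtMost_iff One_nat_def)
  qed (auto simp: inv)
  then show ?thesis
    by (simp add: entry_def transpose_entry_def inv bij_betw_same_card)
qed

lemma count_matrix_symmetric:
  assumes "a < q" "b < q"
  shows "count_matrix n q \<sigma> s (max a b, min a b) = card {i \<in> {1..n}. s i = a \<and> s (\<sigma> i) = b}"
proof -
  have "card {i \<in> {1..n}. s i = a \<and> s (\<sigma> i) = b} = card {i \<in> {1..n}. s i = b \<and> s (\<sigma> i) = a}"
    by (rule bij_betw_same_card[of \<sigma>], rule bij_betw_byWitness[where f' = \<sigma>])
       (auto simp: inv mem simp del: atLeastAtMost_iff One_nat_def)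
  then show ?thesis
    using assms by (auto simp: count_matrix_def cells_def max_def min_def)
qed

lemma entry_image: "entry n \<sigma> s ` {1..n} = entries q (count_matrix n q \<sigma> s)"
proof (intro equalityI subsetI)
  fix e assume "e \<in> entry n \<sigma> s ` {1..n}"
  then obtain i where i: "i \<in> {1..n}" "e = entry n \<sigma> s i" by blast
  have lt: "s i < q" "s (\<sigma> i) < q" using less i(1) mem by blast+
  have "card {j \<in> {1..n}. j < i \<and> s j = s i \<and> s (\<sigma> j) = s (\<sigma> i)} <
        card {j \<in> {1..n}. s j = s i \<and> s (\<sigma> j) = s (\<sigma> i)}"
    by (rule psubset_card_mono) (use i in auto)
  then show "e \<in> entries q (count_matrix n q \<sigma> s)"
    using i lt by (simp add: entries_def entry_def count_matrix_symmetric)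
next
  fix e assume "e \<in> entries q (count_matrix n q \<sigma> s)"
  then obtain a b k where e: "e = (a, b, k)" "a < q" "b < q" "k < count_matrix n q \<sigma> s (max a b, min a b)"
    by (auto simp: entries_def)
  define C where "C = {i \<in> {1..n}. s i = a \<and> s (\<sigma> i) = b}"
  have "k \<in> {..<card C}" using e by (simp add: C_def count_matrix_symmetric)
  then have "k \<in> (\<lambda>i. card {j \<in> C. j < i}) ` C"
    by (subst rank_image) (simp_all add: C_def)
  then obtain i where i: "i \<in> C" "k = card {j \<in> C. j < i}" by blast
  have "{j \<in> {1..n}. j < i \<and> s j = s i \<and> s (\<sigma> j) = s (\<sigma> i)} = {j \<in> C. j < i}"
    using i(1) by (auto simp: C_def)
  then have "e = entry n \<sigma> s i" using i e by (simp add: entry_def C_def)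
  then show "e \<in> entry n \<sigma> s ` {1..n}" using i by (simp add: C_def)
qed

lemma count_matrix_mem: "count_matrix n q \<sigma> s \<in> arrays (cells q) cell_weight n"
proof -
  have "card (entry n \<sigma> s ` {1..n}) = n"
    using strict_mono_on_imp_inj_on[OF strict_mono_entry] by (simp add: card_image)
  then have "(\<Sum>p\<in>cells q. cell_weight p * count_matrix n q \<sigma> s p) = n"
    by (simp only: entry_image card_entries)
  then show ?thesis by (auto simp: arrays_def count_matrix_def)
qed

text \<open>
  The units below the diagonal correspond to the indices with $s_{\sigma(i)} < s_i$. These are the
  indices with $\sigma(i) < i$: if $\sigma(i) < i$ lay in the same block, then monotonicity of
  $\sigma$ on that block would give $i = \sigma(\sigma(i)) < \sigma(i)$.
\<close>

lemma count_matrix_sign: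
  "(\<Prod>p\<in>cells q. cell_sign p ^ count_matrix n q \<sigma> s p) = sign \<sigma>"
proof -
  define S where "S = {i \<in> {1..n}. s (\<sigma> i) < s i}"
  have desc: "s (\<sigma> i) < s i \<longleftrightarrow> \<sigma> i < i" if i: "i \<in> {1..n}" for i
  proof
    assume "s (\<sigma> i) < s i"
    then show "\<sigma> i < i" using mono[of i "\<sigma> i"] i mem[of i] by linarith
  next
    assume lt: "\<sigma> i < i"
    then have "s (\<sigma> i) \<le> s i" 
      using mono[OF iffD2[OF mem i] i] by simp
    moreover have "s (\<sigma> i) \<noteq> s i"
      using incr[of "\<sigma> i" i] lt i mem[of i] inv[of i] by force
    ultimately show "s (\<sigma> i) < s i" by simp
  qed
  have "{i. \<sigma> i < i} = S"
    using permutes_descents_subset[of \<sigma> "{1..n}"] \<sigma> desc by (auto simp: S_def involutions_def)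
  have cell: "cell_sign p ^ count_matrix n q \<sigma> s p = (- 1) ^ card {i \<in> S. (s i, s (\<sigma> i)) = p}"
    if p: "p \<in> cells q" for p
  proof -
    obtain b a where ba: "p = (b, a)" "b < q" "a \<le> b" using p by (auto simp: cells_def)
    show ?thesis
    proof (cases "a = b")
      case True
      then have "{i \<in> S. (s i, s (\<sigma> i)) = p} = {}" using ba by (auto simp: S_def)
      moreover have "cell_sign p = 1" using True ba by (simp add: cell_sign_def)
      ultimately show ?thesis by (simp only: power_one card.empty power_0)
    next
      case False
      then have "{i \<in> S. (s i, s (\<sigma> i)) = p} = {i \<in> {1..n}. s i = b \<and> s (\<sigma> i) = a}"
        using ba by (auto simp: S_def)
      then show ?thesis using False ba p by (simp add: cell_sign_def count_matrix_def)
    qed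
  qed
  have "(\<Prod>p\<in>cells q. cell_sign p ^ count_matrix n q \<sigma> s p) =
      (- 1) ^ (\<Sum>p\<in>cells q. card {i \<in> S. (s i, s (\<sigma> i)) = p})"
    by (simp add: cell power_sum cong: prod.cong)
  also have "(\<Sum>p\<in>cells q. card {i \<in> S. (s i, s (\<sigma> i)) = p}) = card S"
    by (rule sum_card_fibres) (use less in \<open>auto simp: S_def cells_def\<close>)
  finally show ?thesis
    using sign_involution[OF \<sigma>] \<open>{i. \<sigma> i < i} = S\<close> by simp
qed

end

text \<open>
  The matrix determines the set of its units, hence their increasing enumeration \<open>entry\<close>, from which
  the word is the first component and the involution is the exchange of the first two components.
\<close>

lemma count_matrix_inj:
  assumes "\<sigma> \<in> involutions n" "s \<in> compatible_words n q \<sigma>"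
    and "\<tau> \<in> involutions n" "t \<in> compatible_words n q \<tau>"
    and eq: "count_matrix n q \<sigma> s = count_matrix n q \<tau> t"
  shows "\<sigma> = \<tau> \<and> s = t"
proof -
  have entry_eq: "entry n \<sigma> s i = entry n \<tau> t i" if "i \<in> {1..n}" for i
    using that
    by (rule strict_mono_on_interval_unique[rotated 3])
       (simp_all only: eq strict_mono_entry[OF assms(1,2)] strict_mono_entry[OF assms(3,4)]
          entry_image[OF assms(1,2)] entry_image[OF assms(3,4)])
  have st: "s i = t i" if "i \<in> {1..n}" for i
    using entry_eq[OF that] by (simp add: entry_def)
  have "s = t"
  proof (rule PiE_ext[OF _ _ st])
    show "s \<in> {1..n} \<rightarrow>\<^sub>E {..<q}" "t \<in> {1..n} \<rightarrow>\<^sub>E {..<q}"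
      using assms(2,4) by (simp_all only: compatible_words_def mem_Collect_eq)
  qed
  moreover have "\<sigma> i = \<tau> i" for i
  proof (cases "i \<in> {1..n}")
    case True
    have mem: "\<sigma> i \<in> {1..n}" "\<tau> i \<in> {1..n}"
      using assms(1,3) True permutes_in_image[of \<sigma> "{1..n}"] permutes_in_image[of \<tau> "{1..n}"]
      by (simp_all only: involutions_def mem_Collect_eq)
    have "entry n \<sigma> s (\<sigma> i) = entry n \<sigma> s (\<tau> i)"
      using entry_eq[OF True] entry_eq[OF mem(2)] entry_involution True assms by simp
    then show ?thesis
      using mem strict_mono_on_imp_inj_on[OF strict_mono_entry[OF assms(1,2)]]
      by (simp add: inj_on_eq_iff)
  next
    case False
    then show ?thesis
      using assms(1,3) by (auto simp: involutions_def permutes_def)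
  qed
  ultimately show ?thesis by auto
qed

text \<open>
  Conversely, number the units of the matrix in lexicographic order; the word records their first
  components and the involution transposes them.
\<close>

lemma count_matrix_surj:
  assumes M: "M \<in> arrays (cells q) cell_weight n"
  obtains \<sigma> s where "\<sigma> \<in> involutions n" "s \<in> compatible_words n q \<sigma>" "count_matrix n q \<sigma> s = M"
proof -
  have "card (entries q M) = n" using M by (simp add: card_entries arrays_def)
  then obtain e where mono: "strict_mono_on {1..n} e" and img: "e ` {1..n} = entries q M"
    using strict_mono_on_interval_exists[of "entries q M"] by auto
  have inj: "inj_on e {1..n}" by (rule strict_mono_on_imp_inj_on[OF mono])
  have e_less: "e i < e j \<longleftrightarrow> i < j" if "i \<in> {1..n}" "j \<in> {1..n}" for i j
    using mono that by (metis linorder_neqE_nat order_less_asym order_less_irrefl strict_mono_onD)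
  have e_in: "e i \<in> entries q M" if "i \<in> {1..n}" for i using img that by blast
  define \<sigma> where "\<sigma> = (\<lambda>i. if i \<in> {1..n} then inv_into {1..n} e (transpose_entry (e i)) else i)"
  define s where "s = (\<lambda>i. if i \<in> {1..n} then fst (e i) else undefined)"
  have tr: "transpose_entry x \<in> e ` {1..n}" if "x \<in> entries q M" for x
    using that unfolding img by (auto simp: entries_def transpose_entry_def max.commute min.commute)
  have \<sigma>_in: "\<sigma> i \<in> {1..n}" and e\<sigma>: "e (\<sigma> i) = transpose_entry (e i)" if "i \<in> {1..n}" for i
    using inv_into_into[OF tr[OF e_in[OF that]]] f_inv_into_f[OF tr[OF e_in[OF that]]] that
    by (simp_all add: \<sigma>_def)
  have \<sigma>\<sigma>: "\<sigma> (\<sigma> i) = i" for i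
  proof (cases "i \<in> {1..n}")
    case True
    have "e (\<sigma> (\<sigma> i)) = e i"
      using True \<sigma>_in e\<sigma> by (simp add: transpose_entry_def split: prod.splits)
    then show ?thesis using inj True \<sigma>_in by (simp add: inj_on_eq_iff)
  next
    case False
    then have "\<sigma> i = i" by (simp only: \<sigma>_def if_False)
    then show ?thesis by simp
  qed
  have "bij_betw \<sigma> {1..n} {1..n}"
    by (rule bij_betw_byWitness[where f' = \<sigma>]) (use \<sigma>\<sigma> \<sigma>_in in auto)
  then have "\<sigma> permutes {1..n}" by (rule bij_imp_permutes) (auto simp: \<sigma>_def)
  then have \<sigma>_inv: "\<sigma> \<in> involutions n" using \<sigma>\<sigma> by (auto simp: involutions_def)
  have s_eq: "s i = fst (e i)" "s (\<sigma> i) = fst (snd (e i))" if "i \<in> {1..n}" for i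
    using that \<sigma>_in e\<sigma> by (simp_all add: s_def transpose_entry_def split: prod.splits)
  have "s i \<le> s (i + 1) \<and> (\<not> \<sigma> i < \<sigma> (i + 1) \<longrightarrow> s i < s (i + 1))" if "1 \<le> i" "i < n" for i
  proof -
    have i: "i \<in> {1..n}" "i + 1 \<in> {1..n}" using that by auto
    have lt: "e i < e (i + 1)" using e_less i by simp
    obtain a b k a' b' k' where e: "e i = (a, b, k)" "e (i + 1) = (a', b', k')"
      by (metis prod_cases3)
    have "\<sigma> i < \<sigma> (i + 1)" if "a = a'"
    proof -
      have "e (\<sigma> i) < e (\<sigma> (i + 1))"
        using lt that unfolding e\<sigma>[OF i(1)] e\<sigma>[OF i(2)] e by (auto simp: transpose_entry_def)
      then show ?thesis using e_less \<sigma>_in i by simp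
    qed
    moreover have "a \<le> a'" using lt unfolding e by auto
    ultimately show ?thesis using i e by (cases "a = a'") (auto simp: s_eq)
  qed
  moreover have "s \<in> {1..n} \<rightarrow>\<^sub>E {..<q}"
    using e_in by (fastforce simp: s_def entries_def)
  ultimately have s_comp: "s \<in> compatible_words n q \<sigma>" by (simp add: compatible_words_def)
  have "count_matrix n q \<sigma> s p = M p" for p
  proof (cases "p \<in> cells q")
    case True
    then obtain b a where p: "p = (b, a)" "b < q" "a \<le> b" by (auto simp: cells_def)
    have "e ` {i \<in> {1..n}. s i = b \<and> s (\<sigma> i) = a} = {x \<in> entries q M. fst x = b \<and> fst (snd x) = a}"
      unfolding img[symmetric] using s_eq by auto
    also have "\<dots> = (\<lambda>k. (b, a, k)) ` {..<M p}"
      using p by (auto simp: entries_def)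
    finally have "card (e ` {i \<in> {1..n}. s i = b \<and> s (\<sigma> i) = a}) = M p"
      by (simp add: card_image inj_on_def)
    moreover have "inj_on e {i \<in> {1..n}. s i = b \<and> s (\<sigma> i) = a}"
      by (rule inj_on_subset[OF inj]) auto
    ultimately show ?thesis using True p by (simp add: count_matrix_def card_image)
  next
    case False
    then show ?thesis using M by (cases p) (auto simp: count_matrix_def arrays_def)
  qed
  then show ?thesis using that \<sigma>_inv s_comp by blast
qed

text \<open>
  Both sides are the signed number of pairs of an involution and a compatible word.
\<close>

lemma sum_sign_binomial:
  "(\<Sum>\<sigma>\<in>involutions n. sign \<sigma> * int ((q + ris n \<sigma>) choose n)) = signed_matrix_count q n"
proof -
  have "(\<Sum>\<sigma>\<in>involutions n. sign \<sigma> * int ((q + ris n \<sigma>) choose n)) =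
      (\<Sum>\<sigma>\<in>involutions n. \<Sum>s\<in>compatible_words n q \<sigma>. sign \<sigma>)"
    by (simp add: card_compatible_words mult.commute)
  also have "\<dots> = (\<Sum>(\<sigma>, s)\<in>(SIGMA \<sigma>:involutions n. compatible_words n q \<sigma>). sign \<sigma>)"
    by (rule sum.Sigma) (simp_all add: finite_involutions finite_compatible_words)
  also have "\<dots> = (\<Sum>x\<in>(SIGMA \<sigma>:involutions n. compatible_words n q \<sigma>).
      \<Prod>p\<in>cells q. cell_sign p ^ (\<lambda>(\<sigma>, s). count_matrix n q \<sigma> s) x p)"
    by (rule sum.cong) (auto simp: count_matrix_sign)
  also have "\<dots> = signed_matrix_count q n"
    unfolding signed_matrix_count_def
  proof (rule sum.reindex_bij_betw)
    show "bij_betw (\<lambda>(\<sigma>, s). count_matrix n q \<sigma> s)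
        (SIGMA \<sigma>:involutions n. compatible_words n q \<sigma>) (arrays (cells q) cell_weight n)"
      (is "bij_betw ?h ?S ?T")
    proof (rule bij_betw_imageI)
      show "inj_on ?h ?S"
        using count_matrix_inj by (auto simp: inj_on_def)
      have "M \<in> ?h ` ?S" if "M \<in> ?T" for M
        using that by (rule count_matrix_surj) force
      then show "?h ` ?S = ?T"
        using count_matrix_mem by auto
    qed
  qed
  finally show ?thesis .
qed

section \<open>Comparing coefficients\<close>

lemma signed_eulerian_conv_sum:
  "signed_eulerian n (int k) = (\<Sum>\<sigma>\<in>involutions n. if ris n \<sigma> = k then sign \<sigma> else 0)"
  by (simp add: signed_eulerian_def signed_eulerian_poly_def coeff_sum)

lemma ris_le: "ris n \<sigma> \<le> n"
  using ris_less[of n \<sigma>] by (cases "n = 0") (auto simp: ris_def)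

lemma signed_eulerian_neg [simp]: "k < 0 \<Longrightarrow> signed_eulerian n k = 0"
  by (simp add: signed_eulerian_def)

lemma signed_eulerian_gt [simp]:
  assumes "int n < k"
  shows "signed_eulerian n k = 0"
proof -
  have "ris n \<sigma> \<noteq> nat k" for \<sigma> using ris_le[of n \<sigma>] assms by linarith
  then show ?thesis
    using signed_eulerian_conv_sum[of n "nat k"] assms by simp
qed

lemma sum_signed_eulerian_binomial:
  "(\<Sum>k\<le>n. signed_eulerian n (int k) * int ((q + k) choose n)) = signed_matrix_count q n"
proof -
  have "(\<Sum>k\<le>n. signed_eulerian n (int k) * int ((q + k) choose n)) =
      (\<Sum>\<sigma>\<in>involutions n. \<Sum>k\<le>n. (if ris n \<sigma> = k then sign \<sigma> else 0) * int ((q + k) choose n))"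
    unfolding signed_eulerian_conv_sum sum_distrib_right by (rule sum.swap)
  also have "\<dots> = (\<Sum>\<sigma>\<in>involutions n. sign \<sigma> * int ((q + ris n \<sigma>) choose n))"
    by (rule sum.cong) (simp_all add: if_distrib[of "\<lambda>x. x * _"] ris_le cong: if_cong)
  finally show ?thesis by (simp add: sum_sign_binomial)
qed

text \<open>
  Evaluation at $q = 0, 1, \dots, n$ is triangular: at $q = n - k$ the binomial coefficients with
  index below $k$ vanish and the one with index $k$ is 1.
\<close>

lemma shifted_binomials_independent:
  fixes c :: "nat \<Rightarrow> int"
  assumes zero: "\<And>q. (\<Sum>k\<le>n. c k * int ((q + k) choose n)) = 0" and "k \<le> n"
  shows "c k = 0"
  using \<open>k \<le> n\<close>
proof (induction "n - k" arbitrary: k rule: less_induct)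
  case less
  have "c i * int ((n - k + i) choose n) = 0" if "i \<in> {..n} - {k}" for i
  proof (cases "i < k")
    case True
    then show ?thesis using less.prems by (simp add: binomial_eq_0)
  next
    case False
    then have "c i = 0" using that by (intro less.hyps) auto
    then show ?thesis by simp
  qed
  then have "(\<Sum>i\<in>{..n} - {k}. c i * int ((n - k + i) choose n)) = 0"
    by (intro sum.neutral ballI)
  moreover have "(\<Sum>i\<le>n. c i * int ((n - k + i) choose n)) = c k * int ((n - k + k) choose n)
      + (\<Sum>i\<in>{..n} - {k}. c i * int ((n - k + i) choose n))"
    by (rule sum.remove) (use less.prems in auto)
  ultimately have "(\<Sum>i\<le>n. c i * int ((n - k + i) choose n)) = c k * int ((n - k + k) choose n)"
    by simp
  then show ?case using zero[of "n - k"] less.prems by simp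
qed

lemma sum_shift_signed_eulerian:
  assumes "m + j \<le> n"
  shows "(\<Sum>k\<le>n. a (int k) * signed_eulerian m (int k - int j) * B k) =
         (\<Sum>k\<le>m. a (int (k + j)) * signed_eulerian m (int k) * B (k + j))"
proof -
  have "(\<Sum>k\<le>m. a (int (k + j)) * signed_eulerian m (int k) * B (k + j)) =
      (\<Sum>k\<in>(\<lambda>k. k + j) ` {..m}. a (int k) * signed_eulerian m (int k - int j) * B k)"
    by (subst sum.reindex) (simp_all add: inj_on_def)
  also have "\<dots> = (\<Sum>k\<le>n. a (int k) * signed_eulerian m (int k - int j) * B k)"
  proof (rule sum.mono_neutral_left)
    have "signed_eulerian m (int k - int j) = 0" if "k \<notin> (\<lambda>k. k + j) ` {..m}" for k
    proof (cases "k < j")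
      case False
      then have "k = (k - j) + j" by simp
      then have "\<not> k - j \<le> m" using that by (metis atMost_iff image_eqI)
      then show ?thesis by (intro signed_eulerian_gt) linarith
    qed simp
    then show "\<forall>k\<in>{..n} - (\<lambda>k. k + j) ` {..m}. a (int k) * signed_eulerian m (int k - int j) * B k = 0"
      by simp
  qed (use assms in auto)
  finally show ?thesis ..
qed

lemma binomial_absorb:
  "(int m + 1) * int (y choose Suc m) = (int y - int m) * int (y choose m)"
proof (induction y arbitrary: m)
  case 0
  then show ?case by (cases m) simp_all
next
  case (Suc y)
  show ?case
  proof (cases m)
    case (Suc m')
    then show ?thesis
      using Suc.IH[of m'] Suc.IH[of m] by (simp add: algebra_simps)
  qed simp
qed

text \<open>
  The following three identities raise the lower index of a binomial coefficient to \<open>m + 3\<close> while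
  multiplying by the coefficient polynomials of \<open>signed_matrix_count_recurrence\<close>. They explain the
  coefficients of the recurrence; the shifted arguments $k + j$ on the right anticipate the shift of
  the summation index. By Pascal's rule everything is a combination of
  $\binom{q+k}{m+i}$ with $i \le 3$, and these are linked by \<open>binomial_absorb\<close>.
\<close>

lemma raise_binomial_1:
  fixes m q k :: nat
  defines "n \<equiv> int m + 3" and "B \<equiv> \<lambda>i. int ((q + i) choose (m + 3))"
  shows "(int m + 2 + int q) * int ((q + k) choose (m + 2)) =
    (2 + int k - n) * B k + (2 * n - int (k + 1) - 1) * B (k + 1)"
  using binomial_absorb[of "m + 2" "q + k"]
  by (simp add: n_def B_def numeral_eq_Suc algebra_simps)

lemma raise_binomial_2:
  fixes m q k :: nat
  defines "n \<equiv> int m + 3" and "B \<equiv> \<lambda>i. int ((q + i) choose (m + 3))"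
  shows "- (int m + 1 + int q * (int q - 1)) * int ((q + k) choose (m + 1)) =
    - (n + 3 * int k + int k ^ 2) * B k
    + (- 2 + 4 * int (k + 1) + 2 * int (k + 1) ^ 2 - 2 * int (k + 1) * n) * B (k + 1)
    + (2 - int (k + 2) - int (k + 2) ^ 2 + 2 * int (k + 2) * n - n ^ 2) * B (k + 2)"
proof -
  define y B1 B2 B3 where "y = int (q + k)" and "B1 = int ((q + k) choose (m + 1))"
    and "B2 = int ((q + k) choose (m + 2))" and "B3 = int ((q + k) choose (m + 3))"
  have B: "B k = B3" "B (k + 1) = B3 + B2" "B (k + 2) = B3 + 2 * B2 + B1"
    by (simp_all add: B_def B1_def B2_def B3_def numeral_eq_Suc)
  have abs: "(int m + 2) * B2 = (y - int m - 1) * B1" "(int m + 3) * B3 = (y - int m - 2) * B2"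
    using binomial_absorb[of "m + 1" "q + k"] binomial_absorb[of "m + 2" "q + k"]
    by (simp_all add: y_def B1_def B2_def B3_def numeral_eq_Suc algebra_simps)
  have x: "int q = y - int k" by (simp add: y_def)
  show ?thesis
    unfolding B x B1_def[symmetric] n_def of_nat_add of_nat_1 of_nat_numeral using abs by algebra
qed

lemma raise_binomial_3:
  fixes m q k :: nat
  defines "n \<equiv> int m + 3" and "B \<equiv> \<lambda>i. int ((q + i) choose (m + 3))"
  shows "(int m + int q ^ 2) * int ((q + k) choose m) =
    (- n - int k ^ 2 - 2 * int k + 2) * B k
    + (- 7 + 4 * int (k + 1) + 3 * int (k + 1) ^ 2 + 2 * n - 2 * int (k + 1) * n) * B (k + 1)
    + (8 - 2 * int (k + 2) - 3 * int (k + 2) ^ 2 - 2 * n + 4 * int (k + 2) * n - n ^ 2) * B (k + 2)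
    + (- 3 + int (k + 3) ^ 2 + n - 2 * int (k + 3) * n + n ^ 2) * B (k + 3)"
proof -
  define y B0 B1 B2 B3 where "y = int (q + k)" and "B0 = int ((q + k) choose m)"
    and "B1 = int ((q + k) choose (m + 1))"
    and "B2 = int ((q + k) choose (m + 2))" and "B3 = int ((q + k) choose (m + 3))"
  have B: "B k = B3" "B (k + 1) = B3 + B2" "B (k + 2) = B3 + 2 * B2 + B1"
    "B (k + 3) = B3 + 3 * B2 + 3 * B1 + B0"
    by (simp_all add: B_def B0_def B1_def B2_def B3_def numeral_eq_Suc)
  have abs: "(int m + 1) * B1 = (y - int m) * B0" "(int m + 2) * B2 = (y - int m - 1) * B1"
     "(int m + 3) * B3 = (y - int m - 2) * B2"
    using binomial_absorb[of m "q + k"] binomial_absorb[of "m + 1" "q + k"] binomial_absorb[of "m + 2" "q + k"]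
    by (simp_all add: y_def B0_def B1_def B2_def B3_def numeral_eq_Suc algebra_simps)
  have x: "int q = y - int k" by (simp add: y_def)
  show ?thesis
    unfolding B x B0_def[symmetric] n_def of_nat_add of_nat_1 of_nat_numeral using abs by algebra
qed

text \<open>
  Summation by parts: an operator acting on the coefficients $f_{m,k}$ by shifts in $k$ is moved over
  to the binomial coefficients, where it amounts to multiplication by \<open>r\<close>. The bound on $m + d$
  ensures that no shifted index leaves the range of summation.
\<close>

lemma sum_shifted_operator:
  assumes "m + d \<le> n"
    and "\<And>k. (\<Sum>j\<le>d. a j (int (k + j)) * int ((q + (k + j)) choose n)) = r * int ((q + k) choose m)"
  shows "(\<Sum>k\<le>n. (\<Sum>j\<le>d. a j (int k) * signed_eulerian m (int k - int j)) * int ((q + k) choose n))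
    = r * signed_matrix_count q m"
proof -
  have "(\<Sum>k\<le>n. (\<Sum>j\<le>d. a j (int k) * signed_eulerian m (int k - int j)) * int ((q + k) choose n))
      = (\<Sum>j\<le>d. \<Sum>k\<le>n. a j (int k) * signed_eulerian m (int k - int j) * int ((q + k) choose n))"
    unfolding sum_distrib_right by (rule sum.swap)
  also have "\<dots> = (\<Sum>j\<le>d. \<Sum>k\<le>m. a j (int (k + j)) * signed_eulerian m (int k) * int ((q + (k + j)) choose n))"
    by (intro sum.cong refl sum_shift_signed_eulerian) (use assms(1) in auto)
  also have "\<dots> = (\<Sum>k\<le>m. \<Sum>j\<le>d. a j (int (k + j)) * signed_eulerian m (int k) * int ((q + (k + j)) choose n))"
    by (rule sum.swap)
  also have "\<dots> = (\<Sum>k\<le>m. signed_eulerian m (int k) * (r * int ((q + k) choose m)))"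
    by (simp only: assms(2)[symmetric] sum_distrib_left mult_ac)
  also have "\<dots> = r * signed_matrix_count q m"
    by (simp only: sum_signed_eulerian_binomial[symmetric] sum_distrib_left mult_ac)
  finally show ?thesis .
qed

theorem mainTheorem4:
  fixes n :: nat and k :: int
  assumes "n \<ge> 3" and "k \<ge> 0"
  shows "int n * signed_eulerian n k =
      (2 + k - int n) * signed_eulerian (n - 1) k
    + (2 * int n - k - 1) * signed_eulerian (n - 1) (k - 1)
    - (int n + 3 * k + k ^ 2) * signed_eulerian (n - 2) k
    + (- 2 + 4 * k + 2 * k ^ 2 - 2 * k * int n) * signed_eulerian (n - 2) (k - 1)
    + (2 - k - k ^ 2 + 2 * k * int n - int n ^ 2) * signed_eulerian (n - 2) (k - 2)
    + (- int n - k ^ 2 - 2 * k + 2) * signed_eulerian (n - 3) k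
    + (- 7 + 4 * k + 3 * k ^ 2 + 2 * int n - 2 * k * int n) * signed_eulerian (n - 3) (k - 1)
    + (8 - 2 * k - 3 * k ^ 2 - 2 * int n + 4 * k * int n - int n ^ 2) * signed_eulerian (n - 3) (k - 2)
    + (- 3 + k ^ 2 + int n - 2 * k * int n + int n ^ 2) * signed_eulerian (n - 3) (k - 3)"
proof (cases "k \<le> int n")
  case False
  \<comment> \<open>Every coefficient in the recurrence has an index beyond its degree bound.\<close>
  then show ?thesis using assms by simp
next
  case True
  obtain m where n: "n = m + 3" using assms(1) by (metis add.commute le_Suc_ex)
  have sub: "n - 1 = m + 2" "n - 2 = m + 1" "n - 3 = m" and int_n: "int n = int m + 3"
    by (simp_all add: n)
  let ?f = signed_eulerian
  have upto: "{..1::nat} = {0, 1}" "{..2::nat} = {0, 1, 2}" "{..3::nat} = {0, 1, 2, 3}"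
    by auto
  define a1 a2 a3 :: "nat \<Rightarrow> int \<Rightarrow> int" where
    "a1 j k = [2 + k - int n, 2 * int n - k - 1] ! j" and
    "a2 j k = [- (int n + 3 * k + k ^ 2), - 2 + 4 * k + 2 * k ^ 2 - 2 * k * int n,
      2 - k - k ^ 2 + 2 * k * int n - int n ^ 2] ! j" and
    "a3 j k = [- int n - k ^ 2 - 2 * k + 2, - 7 + 4 * k + 3 * k ^ 2 + 2 * int n - 2 * k * int n,
      8 - 2 * k - 3 * k ^ 2 - 2 * int n + 4 * k * int n - int n ^ 2,
      - 3 + k ^ 2 + int n - 2 * k * int n + int n ^ 2] ! j"
    for j k
  define R where "R k = (\<Sum>j\<le>1. a1 j k * ?f (m + 2) (k - int j))
      + (\<Sum>j\<le>2. a2 j k * ?f (m + 1) (k - int j)) + (\<Sum>j\<le>3. a3 j k * ?f m (k - int j))" for k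
  have "(\<Sum>k\<le>n. (int n * ?f n (int k) - R (int k)) * int ((q + k) choose n)) = 0" for q
  proof -
    let ?A = "signed_matrix_count q"
    have "(\<Sum>k\<le>n. (\<Sum>j\<le>1. a1 j (int k) * ?f (m + 2) (int k - int j)) * int ((q + k) choose n))
        = (int m + 2 + int q) * ?A (m + 2)"
    proof (rule sum_shifted_operator)
      show "(\<Sum>j\<le>1. a1 j (int (k + j)) * int ((q + (k + j)) choose n)) =
          (int m + 2 + int q) * int ((q + k) choose (m + 2))" for k
        unfolding raise_binomial_1 by (simp add: upto a1_def n add.assoc)
    qed (simp add: n)
    moreover have "(\<Sum>k\<le>n. (\<Sum>j\<le>2. a2 j (int k) * ?f (m + 1) (int k - int j)) * int ((q + k) choose n))
        = - (int m + 1 + int q * (int q - 1)) * ?A (m + 1)"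
    proof (rule sum_shifted_operator)
      show "(\<Sum>j\<le>2. a2 j (int (k + j)) * int ((q + (k + j)) choose n)) =
          - (int m + 1 + int q * (int q - 1)) * int ((q + k) choose (m + 1))" for k
        unfolding raise_binomial_2 by (simp add: upto a2_def n add_ac)
    qed (simp add: n)
    moreover have "(\<Sum>k\<le>n. (\<Sum>j\<le>3. a3 j (int k) * ?f m (int k - int j)) * int ((q + k) choose n))
        = (int m + int q ^ 2) * ?A m"
    proof (rule sum_shifted_operator)
      show "(\<Sum>j\<le>3. a3 j (int (k + j)) * int ((q + (k + j)) choose n)) =
          (int m + int q ^ 2) * int ((q + k) choose m)" for k
        unfolding raise_binomial_3 by (simp add: upto a3_def n algebra_simps power2_eq_square)
    qed (simp add: n)
    moreover have "(\<Sum>k\<le>n. int n * ?f n (int k) * int ((q + k) choose n)) = int n * ?A n"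
      by (simp only: sum_signed_eulerian_binomial[symmetric] sum_distrib_left mult.assoc)
    ultimately show ?thesis
      using signed_matrix_count_recurrence[of m q]
      by (simp add: R_def left_diff_distrib distrib_right sum_subtractf sum.distrib n)
  qed
  from shifted_binomials_independent[OF this, of "nat k"]
  have "int n * ?f n k = R k"
    using True assms(2) by simp
  then show ?thesis
    unfolding sub by (simp add: R_def upto a1_def a2_def a3_def algebra_simps)
qed

end
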